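(* Let $M$ be an Orlicz function and let $m,n\ge0$ be integers. (a) If $1\le p<q<\infty$, then (i) $C_p^F(M,\Delta_m^n)\subset C_q^F(M,\Delta_m^n)$ and (ii) $\ell_p^F(M,\Delta_m^n)\subset\ell_q^F(M,\Delta_m^n)$. (b) For $1\le p<\infty$, $C_p^F(M)\subset C_p^F(M,\Delta_m^n)$ for all $m\ge1$ and $n\ge1$. (Here $\subset$ denotes inclusion, not necessarily strict.)
   Context: $N=\{1,2,3,\dots\}$. An Orlicz function is a continuous, non-decreasing, convex function $M:[0,\infty)\to[0,\infty)$ with $M(0)=0$, $M(x)>0$ for $x>0$, and $M(x)\to\infty$ as $x\to\infty$. A fuzzy real number is a map $X:\mathbb R\to[0,1]$. It is convex if $X(t)\ge\min(X(s),X(r))$ whenever $s<t<r$, normal if $X(t_0)=1$ for some $t_0$, and upper semi-continuous if $X^{-1}([0,a+\varepsilon))$ is open for every $\varepsilon>0$ and $a\in[0,1]$. For $0<\alpha\le1$, $X^\alpha=\{t: X(t)\ge\alpha\}$, and $X^0$ is the closure of $\{t:X(t)>0\}$. $R(I)$ denotes the set of upper semi-continuous, normal, convex fuzzy real numbers, with all level sets $X^\alpha$ ($0\le\alpha\le1$) closed bounded intervals. For closed bounded intervals $A=[A^L,A^R]$, $B=[B^L,B^R]$ put $d(A,B)=\max\{|A^L-B^L|,|A^R-B^R|\}$, and for $X,Y\in R(I)$ put $\overline d(X,Y)=\sup_{0<\alpha\le1}d(X^\alpha,Y^\alpha)$. For $r\in\mathbb R$, $\overline r\in R(I)$ is defined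 by $\overline r(t)=1$ if $t=r$ and $0$ otherwise. Subtraction in $R(I)$ is the usual levelwise interval subtraction: if $X^\alpha=[a,b]$ and $Y^\alpha=[c,e]$ then $(X-Y)^\alpha=[a-e,b-c]$. For a sequence $(X_k)_{k\in N}$ in $R(I)$ and $m,n\ge1$: $\Delta_m^0X_k=X_k$ and $\Delta_m^nX_k=\Delta_m^{n-1}X_k-\Delta_m^{n-1}X_{k+m}$; if $m=0$ or $n=0$, $\Delta_m^nX_k=X_k$. For $1\le p<\infty$ the spaces consist of sequences $(X_k)$ in $R(I)$ satisfying, for some $\rho>0$, with $t_k=M\left(\overline d(\Delta_m^nX_k,\overline0)/\rho\right)$: - $C_p^F(M,\Delta_m^n)$: $\sum_{i=1}^\infty\left(\frac1i\sum_{k=1}^i t_k\right)^p<\infty$; - $\ell_p^F(M,\Delta_m^n)$: $\sum_{k=1}^\infty t_k^p<\infty$. $C_p^F(M)$ is the space obtained from $C_p^F(M,\Delta_m^n)$ by replacing $\Delta_m^nX_k$ by $X_k$. *)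

theory Defs
  imports "HOL-Analysis.Analysis"
begin

definition orlicz :: "(real \<Rightarrow> real) \<Rightarrow> bool" where
  "orlicz M \<longleftrightarrow>
     M ` {0..} \<subseteq> {0..} \<and> continuous_on {0..} M \<and> mono_on {0..} M \<and> convex_on {0..} M \<and>
     M 0 = 0 \<and> (\<forall>x>0. M x > 0) \<and> filterlim M at_top at_top"

section \<open>Fuzzy real numbers\<close>

type_synonym fuzzy = "real \<Rightarrow> real"

definition fuzzy_convex :: "fuzzy \<Rightarrow> bool" where
  "fuzzy_convex X \<longleftrightarrow> (\<forall>s t r. s < t \<and> t < r \<longrightarrow> X t \<ge> min (X s) (X r))"

definition fuzzy_normal :: "fuzzy \<Rightarrow> bool" where
  "fuzzy_normal X \<longleftrightarrow> (\<exists>t. X t = 1)"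

definition fuzzy_usc :: "fuzzy \<Rightarrow> bool" where
  "fuzzy_usc X \<longleftrightarrow> (\<forall>\<epsilon>>0. \<forall>a\<in>{0..1}. open (X -` {0..<a + \<epsilon>}))"

definition level :: "fuzzy \<Rightarrow> real \<Rightarrow> real set" where
  "level X \<alpha> = (if \<alpha> = 0 then closure {t. X t > 0} else {t. X t \<ge> \<alpha>})"

definition RI :: "fuzzy set" where
  "RI = {X. range X \<subseteq> {0..1} \<and> fuzzy_usc X \<and> fuzzy_normal X \<and> fuzzy_convex X \<and>
            (\<forall>\<alpha>\<in>{0..1}. \<exists>a b. a \<le> b \<and> level X \<alpha> = {a..b})}"

definition crisp :: "real \<Rightarrow> fuzzy" where
  "crisp r = (\<lambda>t. if t = r then 1 else 0)"

text \<open>Distance and subtraction of nonempty compact intervals; the endpoints of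
  \<open>A = {a..b}\<close> are \<open>Inf A = a\<close> and \<open>Sup A = b\<close>.\<close>

definition interval_dist :: "real set \<Rightarrow> real set \<Rightarrow> real" where
  "interval_dist A B = max \<bar>Inf A - Inf B\<bar> \<bar>Sup A - Sup B\<bar>"

definition interval_minus :: "real set \<Rightarrow> real set \<Rightarrow> real set" where
  "interval_minus A B = {Inf A - Sup B .. Sup A - Inf B}"

definition fuzzy_dist :: "fuzzy \<Rightarrow> fuzzy \<Rightarrow> real" where
  "fuzzy_dist X Y = (SUP \<alpha>\<in>{0<..1}. interval_dist (level X \<alpha>) (level Y \<alpha>))"

text \<open>The fuzzy number whose level sets are the differences of the level sets of \<open>X\<close> and \<open>Y\<close>,
  reconstructed from these level sets; see \<open>level_fuzzy_minus\<close> and \<open>fuzzy_minus_in_RI\<close> below.\<close>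

definition fuzzy_minus :: "fuzzy \<Rightarrow> fuzzy \<Rightarrow> fuzzy" where
  "fuzzy_minus X Y =
     (\<lambda>t. Sup (insert 0 {\<alpha>\<in>{0<..1}. t \<in> interval_minus (level X \<alpha>) (level Y \<alpha>)}))"

lemma RI_level:
  assumes "X \<in> RI" "0 \<le> \<alpha>" "\<alpha> \<le> 1"
  shows "level X \<alpha> = {Inf (level X \<alpha>) .. Sup (level X \<alpha>)}"
    and "Inf (level X \<alpha>) \<le> Sup (level X \<alpha>)"
proof -
  obtain a b where "a \<le> b" "level X \<alpha> = {a..b}"
    using assms unfolding RI_def by (auto dest!: bspec[of _ _ \<alpha>])
  then show "level X \<alpha> = {Inf (level X \<alpha>) .. Sup (level X \<alpha>)}"
    and "Inf (level X \<alpha>) \<le> Sup (level X \<alpha>)" by auto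
qed

lemma RI_level_iff:
  assumes "X \<in> RI" "0 \<le> \<alpha>" "\<alpha> \<le> 1"
  shows "t \<in> level X \<alpha> \<longleftrightarrow> Inf (level X \<alpha>) \<le> t \<and> t \<le> Sup (level X \<alpha>)"
  using RI_level(1)[OF assms] by (metis atLeastAtMost_iff)

lemma level_antimono:
  assumes "0 \<le> \<beta>" "\<beta> \<le> \<alpha>"
  shows "level X \<alpha> \<subseteq> level X \<beta>"
proof (cases "\<beta> = 0 \<and> \<alpha> \<noteq> 0")
  case True
  then have "level X \<alpha> \<subseteq> {t. X t > 0}" using assms by (auto simp: level_def)
  also have "\<dots> \<subseteq> closure {t. X t > 0}" by (rule closure_subset)
  finally show ?thesis using True by (simp add: level_def)
next
  case False
  then show ?thesis using assms by (auto simp: level_def)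
qed

lemma endpoints_mono:
  assumes "X \<in> RI" "0 \<le> \<beta>" "\<beta> \<le> \<alpha>" "\<alpha> \<le> 1"
  shows "Inf (level X \<beta>) \<le> Inf (level X \<alpha>)" "Sup (level X \<alpha>) \<le> Sup (level X \<beta>)"
proof -
  have "{Inf (level X \<alpha>) .. Sup (level X \<alpha>)} \<subseteq> {Inf (level X \<beta>) .. Sup (level X \<beta>)}"
    using level_antimono[OF assms(2,3), of X] RI_level(1)[of X \<alpha>] RI_level(1)[of X \<beta>] assms
    by simp
  then show "Inf (level X \<beta>) \<le> Inf (level X \<alpha>)" "Sup (level X \<alpha>) \<le> Sup (level X \<beta>)"
    using RI_level(2)[of X \<alpha>] assms by auto
qed

text \<open>Hence the supremum in \<open>fuzzy_dist\<close> is a genuine one on \<open>RI\<close>.\<close>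

lemma bdd_above_interval_dist:
  assumes X: "X \<in> RI" and Y: "Y \<in> RI"
  shows "bdd_above ((\<lambda>\<alpha>. interval_dist (level X \<alpha>) (level Y \<alpha>)) ` {0<..1})"
proof (rule bdd_aboveI2)
  fix \<alpha> :: real assume a: "\<alpha> \<in> {0<..1}"
  then show "interval_dist (level X \<alpha>) (level Y \<alpha>)
      \<le> \<bar>Inf (level X 0)\<bar> + \<bar>Sup (level X 0)\<bar> + \<bar>Inf (level Y 0)\<bar> + \<bar>Sup (level Y 0)\<bar>"
    using endpoints_mono[OF X, of 0 \<alpha>] endpoints_mono[OF Y, of 0 \<alpha>]
      RI_level(2)[OF X, of \<alpha>] RI_level(2)[OF Y, of \<alpha>]
    unfolding interval_dist_def by auto
qed

lemma Inf_level_approx: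
  assumes X: "X \<in> RI" and \<alpha>: "0 < \<alpha>" "\<alpha> \<le> 1" and u: "u < Inf (level X \<alpha>)"
  shows "\<exists>\<beta>. 0 < \<beta> \<and> \<beta> < \<alpha> \<and> u < Inf (level X \<beta>)"
proof (rule ccontr)
  assume "\<not> ?thesis"
  then have le: "Inf (level X \<beta>) \<le> u" if "0 < \<beta>" "\<beta> < \<alpha>" for \<beta> using that by force
  have "\<beta> \<le> X u" if b: "0 < \<beta>" "\<beta> < \<alpha>" for \<beta>
  proof -
    have "u \<le> Sup (level X \<beta>)"
      using u RI_level(2)[OF X, of \<alpha>] endpoints_mono(2)[OF X, of \<beta> \<alpha>] \<alpha> b by linarith
    then have "u \<in> level X \<beta>" using le[OF b] RI_level_iff[OF X, of \<beta> u] b \<alpha> by simp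
    then show ?thesis using b by (simp add: level_def)
  qed
  then have "\<alpha> \<le> X u" using dense_le_bounded[OF \<alpha>(1), of "X u"] by blast
  then have "u \<in> level X \<alpha>" using \<alpha> by (simp add: level_def)
  then show False using u RI_level_iff[OF X, of \<alpha> u] \<alpha> by simp
qed

lemma Sup_level_approx:
  assumes X: "X \<in> RI" and \<alpha>: "0 < \<alpha>" "\<alpha> \<le> 1" and u: "u > Sup (level X \<alpha>)"
  shows "\<exists>\<beta>. 0 < \<beta> \<and> \<beta> < \<alpha> \<and> u > Sup (level X \<beta>)"
proof (rule ccontr)
  assume "\<not> ?thesis"
  then have le: "Sup (level X \<beta>) \<ge> u" if "0 < \<beta>" "\<beta> < \<alpha>" for \<beta> using that by force
  have "\<beta> \<le> X u" if b: "0 < \<beta>" "\<beta> < \<alpha>" for \<beta>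
  proof -
    have "u \<ge> Inf (level X \<beta>)"
      using u RI_level(2)[OF X, of \<alpha>] endpoints_mono(1)[OF X, of \<beta> \<alpha>] \<alpha> b by linarith
    then have "u \<in> level X \<beta>" using le[OF b] RI_level_iff[OF X, of \<beta> u] b \<alpha> by simp
    then show ?thesis using b by (simp add: level_def)
  qed
  then have "\<alpha> \<le> X u" using dense_le_bounded[OF \<alpha>(1), of "X u"] by blast
  then have "u \<in> level X \<alpha>" using \<alpha> by (simp add: level_def)
  then show False using u RI_level_iff[OF X, of \<alpha> u] \<alpha> by simp
qed

lemma interval_minus_antimono:
  assumes "X \<in> RI" "Y \<in> RI" "0 \<le> \<beta>" "\<beta> \<le> \<alpha>" "\<alpha> \<le> 1"
  shows "interval_minus (level X \<alpha>) (level Y \<alpha>) \<subseteq> interval_minus (level X \<beta>) (level Y \<beta>)"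
  using endpoints_mono[OF assms(1,3,4,5)] endpoints_mono[OF assms(2,3,4,5)]
  by (auto simp: interval_minus_def)

lemma interval_minus_left_continuous:
  assumes X: "X \<in> RI" and Y: "Y \<in> RI" and \<alpha>: "0 < \<alpha>" "\<alpha> \<le> 1"
    and t: "\<And>\<beta>. 0 < \<beta> \<Longrightarrow> \<beta> < \<alpha> \<Longrightarrow> t \<in> interval_minus (level X \<beta>) (level Y \<beta>)"
  shows "t \<in> interval_minus (level X \<alpha>) (level Y \<alpha>)"
proof -
  have "Inf (level X \<alpha>) - Sup (level Y \<alpha>) \<le> t"
  proof (rule ccontr)
    assume "\<not> ?thesis"
    moreover define e where "e = (Inf (level X \<alpha>) - Sup (level Y \<alpha>) - t) / 2"
    ultimately have e: "e > 0" "Inf (level X \<alpha>) - Sup (level Y \<alpha>) = t + 2 * e"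
      by (simp_all add: field_simps)
    obtain b where b: "0 < b" "b < \<alpha>" "Inf (level X \<alpha>) - e < Inf (level X b)"
      using Inf_level_approx[OF X \<alpha>, of "Inf (level X \<alpha>) - e"] e by auto
    obtain c where c: "0 < c" "c < \<alpha>" "Sup (level Y \<alpha>) + e > Sup (level Y c)"
      using Sup_level_approx[OF Y \<alpha>, of "Sup (level Y \<alpha>) + e"] e by auto
    define m where "m = max b c"
    have m: "0 < m" "m < \<alpha>" "b \<le> m" "c \<le> m" "m \<le> 1" using b c \<alpha> by (auto simp: m_def)
    have "Inf (level X b) \<le> Inf (level X m)" using endpoints_mono(1)[OF X _ m(3,5)] b by simp
    moreover have "Sup (level Y m) \<le> Sup (level Y c)"
      using endpoints_mono(2)[OF Y _ m(4,5)] c by simp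
    moreover have "t \<in> interval_minus (level X m) (level Y m)" using t m by blast
    ultimately show False
      using b(3) c(3) e(2) unfolding interval_minus_def atLeastAtMost_iff by linarith
  qed
  moreover have "t \<le> Sup (level X \<alpha>) - Inf (level Y \<alpha>)"
  proof (rule ccontr)
    assume "\<not> ?thesis"
    moreover define e where "e = (t - (Sup (level X \<alpha>) - Inf (level Y \<alpha>))) / 2"
    ultimately have e: "e > 0" "Sup (level X \<alpha>) - Inf (level Y \<alpha>) = t - 2 * e"
      by (simp_all add: field_simps)
    obtain b where b: "0 < b" "b < \<alpha>" "Inf (level Y \<alpha>) - e < Inf (level Y b)"
      using Inf_level_approx[OF Y \<alpha>, of "Inf (level Y \<alpha>) - e"] e by auto
    obtain c where c: "0 < c" "c < \<alpha>" "Sup (level X \<alpha>) + e > Sup (level X c)"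
      using Sup_level_approx[OF X \<alpha>, of "Sup (level X \<alpha>) + e"] e by auto
    define m where "m = max b c"
    have m: "0 < m" "m < \<alpha>" "b \<le> m" "c \<le> m" "m \<le> 1" using b c \<alpha> by (auto simp: m_def)
    have "Inf (level Y b) \<le> Inf (level Y m)" using endpoints_mono(1)[OF Y _ m(3,5)] b by simp
    moreover have "Sup (level X m) \<le> Sup (level X c)"
      using endpoints_mono(2)[OF X _ m(4,5)] c by simp
    moreover have "t \<in> interval_minus (level X m) (level Y m)" using t m by blast
    ultimately show False
      using b(3) c(3) e(2) unfolding interval_minus_def atLeastAtMost_iff by linarith
  qed
  ultimately show ?thesis by (simp add: interval_minus_def)
qed

lemma fuzzy_minus_range: "0 \<le> fuzzy_minus X Y t" "fuzzy_minus X Y t \<le> 1"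
proof -
  let ?S = "insert 0 {\<alpha>\<in>{0<..1}. t \<in> interval_minus (level X \<alpha>) (level Y \<alpha>)}"
  have "bdd_above ?S" by (rule bdd_aboveI[of _ 1]) auto
  then show "0 \<le> fuzzy_minus X Y t" unfolding fuzzy_minus_def by (intro cSup_upper) auto
  show "fuzzy_minus X Y t \<le> 1" unfolding fuzzy_minus_def by (rule cSup_least) auto
qed

lemma level_fuzzy_minus_pos:
  assumes X: "X \<in> RI" and Y: "Y \<in> RI" and \<alpha>: "0 < \<alpha>" "\<alpha> \<le> 1"
  shows "level (fuzzy_minus X Y) \<alpha> = interval_minus (level X \<alpha>) (level Y \<alpha>)"
proof -
  have "\<alpha> \<le> fuzzy_minus X Y t \<longleftrightarrow> t \<in> interval_minus (level X \<alpha>) (level Y \<alpha>)" for t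
  proof
    let ?S = "insert 0 {\<alpha>\<in>{0<..1}. t \<in> interval_minus (level X \<alpha>) (level Y \<alpha>)}"
    have bdd: "bdd_above ?S" by (rule bdd_aboveI[of _ 1]) auto
    show "\<alpha> \<le> fuzzy_minus X Y t" if "t \<in> interval_minus (level X \<alpha>) (level Y \<alpha>)"
      unfolding fuzzy_minus_def using that \<alpha> bdd by (intro cSup_upper) auto
    assume le: "\<alpha> \<le> fuzzy_minus X Y t"
    show "t \<in> interval_minus (level X \<alpha>) (level Y \<alpha>)"
    proof (rule interval_minus_left_continuous[OF X Y \<alpha>])
      fix \<beta> assume b: "0 < \<beta>" "\<beta> < \<alpha>"
      then have "\<beta> < Sup ?S" using le unfolding fuzzy_minus_def by simp
      then obtain \<gamma> where "\<gamma> \<in> ?S" "\<beta> < \<gamma>" using less_cSup_iff[OF _ bdd] by blast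
      then show "t \<in> interval_minus (level X \<beta>) (level Y \<beta>)"
        using interval_minus_antimono[OF X Y, of \<beta> \<gamma>] b by auto
    qed
  qed
  then show ?thesis using \<alpha> by (auto simp: level_def)
qed

lemma interval_minus_eq_differences:
  assumes "X \<in> RI" "Y \<in> RI" "0 \<le> \<alpha>" "\<alpha> \<le> 1"
  shows "interval_minus (level X \<alpha>) (level Y \<alpha>) = {x - y | x y. x \<in> level X \<alpha> \<and> y \<in> level Y \<alpha>}"
proof -
  obtain a b where A: "a \<le> b" "level X \<alpha> = {a..b}" using RI_level[OF assms(1,3,4)] by blast
  obtain c e where B: "c \<le> e" "level Y \<alpha> = {c..e}" using RI_level[OF assms(2,3,4)] by blast
  have "\<exists>x y. t = x - y \<and> x \<in> {a..b} \<and> y \<in> {c..e}" if "a - e \<le> t" "t \<le> b - c" for t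
    using that A B by (intro exI[of _ "max a (t + c)"] exI[of _ "max a (t + c) - t"]) auto
  then show ?thesis using A B by (force simp: interval_minus_def)
qed

lemma level_fuzzy_minus:
  assumes X: "X \<in> RI" and Y: "Y \<in> RI" and \<alpha>: "0 \<le> \<alpha>" "\<alpha> \<le> 1"
  shows "level (fuzzy_minus X Y) \<alpha> = interval_minus (level X \<alpha>) (level Y \<alpha>)"
proof (cases "\<alpha> = 0")
  case False
  then show ?thesis using level_fuzzy_minus_pos[OF X Y] \<alpha> by simp
next
  case True
  let ?Z = "fuzzy_minus X Y"
  let ?I = "interval_minus (level X 0) (level Y 0)"
  have pos: "?Z t > 0 \<longleftrightarrow> (\<exists>x y. t = x - y \<and> X x > 0 \<and> Y y > 0)" for t
  proof
    assume p: "?Z t > 0"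
    then have "t \<in> level ?Z (?Z t)" by (simp add: level_def)
    then have "t \<in> interval_minus (level X (?Z t)) (level Y (?Z t))"
      using level_fuzzy_minus_pos[OF X Y p] fuzzy_minus_range by simp
    then obtain x y where "t = x - y" "x \<in> level X (?Z t)" "y \<in> level Y (?Z t)"
      using interval_minus_eq_differences[OF X Y, of "?Z t"] p fuzzy_minus_range(2)[of X Y t]
      by auto
    moreover from this have "?Z t \<le> X x" "?Z t \<le> Y y" using p by (simp_all add: level_def)
    ultimately show "\<exists>x y. t = x - y \<and> X x > 0 \<and> Y y > 0"
      using p by (intro exI[of _ x] exI[of _ y]) linarith
  next
    assume "\<exists>x y. t = x - y \<and> X x > 0 \<and> Y y > 0"
    then obtain x y where t: "t = x - y" "X x > 0" "Y y > 0" by auto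
    define \<gamma> where "\<gamma> = min (X x) (Y y)"
    have "X x \<le> 1" using X unfolding RI_def by (auto dest!: range_subsetD[of X _ x])
    then have g: "0 < \<gamma>" "\<gamma> \<le> 1" "\<gamma> \<le> X x" "\<gamma> \<le> Y y"
      using t unfolding \<gamma>_def by linarith+
    then have "t \<in> interval_minus (level X \<gamma>) (level Y \<gamma>)"
      using interval_minus_eq_differences[OF X Y, of \<gamma>] t by (auto simp: level_def)
    then have "\<gamma> \<le> ?Z t"
      using level_fuzzy_minus_pos[OF X Y g(1,2)] g by (auto simp: level_def)
    then show "?Z t > 0" using g by simp
  qed
  have "closure {t. ?Z t > 0} \<subseteq> ?I"
  proof (rule closure_minimal)
    show "closed ?I" by (simp add: interval_minus_def)
    have "{x. X x > 0} \<subseteq> level X 0" "{x. Y x > 0} \<subseteq> level Y 0"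
      by (simp_all add: level_def closure_subset)
    then show "{t. ?Z t > 0} \<subseteq> ?I"
      unfolding pos using interval_minus_eq_differences[OF X Y, of 0] by auto
  qed
  moreover have "?I \<subseteq> closure {t. ?Z t > 0}"
  proof
    fix t assume "t \<in> ?I"
    then obtain x y where t: "t = x - y" "x \<in> closure {x. X x > 0}" "y \<in> closure {x. Y x > 0}"
      using interval_minus_eq_differences[OF X Y, of 0] by (auto simp: level_def)
    obtain f where f: "\<And>n. X (f n) > 0" "f \<longlonglongrightarrow> x" using t(2) by (auto simp: closure_sequential)
    obtain g where g: "\<And>n. Y (g n) > 0" "g \<longlonglongrightarrow> y" using t(3) by (auto simp: closure_sequential)
    have "(\<lambda>n. f n - g n) \<longlonglongrightarrow> t" using f g t by (auto intro: tendsto_diff)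
    moreover have "?Z (f n - g n) > 0" for n using f g pos by blast
    ultimately show "t \<in> closure {t. ?Z t > 0}"
      unfolding closure_sequential by (intro exI[of _ "\<lambda>n. f n - g n"]) auto
  qed
  ultimately show ?thesis using True by (simp add: level_def)
qed

lemma fuzzy_minus_in_RI:
  assumes X: "X \<in> RI" and Y: "Y \<in> RI"
  shows "fuzzy_minus X Y \<in> RI"
proof -
  let ?Z = "fuzzy_minus X Y"
  have iv: "\<exists>a b. a \<le> b \<and> level ?Z \<alpha> = {a..b}" if "\<alpha> \<in> {0..1}" for \<alpha>
    using that level_fuzzy_minus[OF X Y, of \<alpha>] RI_level(2)[OF X, of \<alpha>] RI_level(2)[OF Y, of \<alpha>]
    by (intro exI[of _ "Inf (level X \<alpha>) - Sup (level Y \<alpha>)"] exI[of _ "Sup (level X \<alpha>) - Inf (level Y \<alpha>)"])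
      (auto simp: interval_minus_def)
  have "fuzzy_normal ?Z"
  proof -
    obtain a b where "a \<le> b" "level ?Z 1 = {a..b}" using iv[of 1] by auto
    then have "a \<in> level ?Z 1" by simp
    then show ?thesis
      using fuzzy_minus_range(2)[of X Y a] by (auto simp: fuzzy_normal_def level_def intro!: exI[of _ a])
  qed
  moreover have "fuzzy_usc ?Z"
    unfolding fuzzy_usc_def
  proof (intro allI impI ballI)
    fix \<epsilon> a :: real assume e: "\<epsilon> > 0" "a \<in> {0..1}"
    show "open (?Z -` {0..<a + \<epsilon>})"
    proof (cases "a + \<epsilon> \<le> 1")
      case True
      have "?Z -` {0..<a + \<epsilon>} = - level ?Z (a + \<epsilon>)"
        using e fuzzy_minus_range(1)[of X Y] by (auto simp: level_def)
      moreover have "closed (level ?Z (a + \<epsilon>))" using iv[of "a + \<epsilon>"] e True by auto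
      ultimately show ?thesis by auto
    next
      case False
      then have "?Z t < a + \<epsilon>" for t using fuzzy_minus_range(2)[of X Y t] by linarith
      then have "?Z -` {0..<a + \<epsilon>} = UNIV" using fuzzy_minus_range(1)[of X Y] by auto
      then show ?thesis by simp
    qed
  qed
  moreover have "fuzzy_convex ?Z"
    unfolding fuzzy_convex_def
  proof (intro allI impI)
    fix s t r :: real assume str: "s < t \<and> t < r"
    define \<gamma> where "\<gamma> = min (?Z s) (?Z r)"
    have g: "0 \<le> \<gamma>" "\<gamma> \<le> 1"
      using fuzzy_minus_range[of X Y] by (auto simp: \<gamma>_def min_le_iff_disj)
    have "\<gamma> \<le> ?Z t"
    proof (cases "\<gamma> = 0")
      case True
      then show ?thesis using fuzzy_minus_range(1)[of X Y t] by simp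
    next
      case False
      then have "s \<in> level ?Z \<gamma>" "r \<in> level ?Z \<gamma>" by (auto simp: level_def \<gamma>_def)
      moreover obtain a b where "level ?Z \<gamma> = {a..b}" using iv[of \<gamma>] g by auto
      ultimately have "t \<in> level ?Z \<gamma>" using str by auto
      then show ?thesis using False by (simp add: level_def)
    qed
    then show "min (?Z s) (?Z r) \<le> ?Z t" by (simp add: \<gamma>_def)
  qed
  ultimately show ?thesis
    using iv fuzzy_minus_range[of X Y] by (auto simp: RI_def)
qed

lemma level_crisp: "0 \<le> \<alpha> \<Longrightarrow> \<alpha> \<le> 1 \<Longrightarrow> level (crisp r) \<alpha> = {r}"
  by (auto simp: level_def crisp_def split: if_splits)

lemma crisp_in_RI: "crisp r \<in> RI"
proof -
  have "open (crisp r -` {0..<c})" for c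
  proof -
    have "crisp r -` {0..<c} = (if c \<le> 0 then {} else if c \<le> 1 then - {r} else UNIV)"
      by (auto simp: crisp_def split: if_splits)
    then show ?thesis by auto
  qed
  then have "fuzzy_usc (crisp r)" by (simp add: fuzzy_usc_def)
  moreover have "\<exists>a b. a \<le> b \<and> level (crisp r) \<alpha> = {a..b}" if "\<alpha> \<in> {0..1}" for \<alpha>
    using that by (intro exI[of _ r]) (simp add: level_crisp)
  ultimately show ?thesis
    by (auto simp: RI_def fuzzy_normal_def fuzzy_convex_def crisp_def)
qed

section \<open>Sequence spaces\<close>

text \<open>Sequences are indexed by the positive integers: a sequence is a function on \<open>nat\<close> of which
  only the terms with index at least 1 matter, so the term at index 0 is left unconstrained.\<close>

primrec fuzzy_Delta :: "nat \<Rightarrow> nat \<Rightarrow> (nat \<Rightarrow> fuzzy) \<Rightarrow> nat \<Rightarrow> fuzzy" where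
  "fuzzy_Delta m 0 X = X"
| "fuzzy_Delta m (Suc n) X =
     (\<lambda>k. if m = 0 then X k else fuzzy_minus (fuzzy_Delta m n X k) (fuzzy_Delta m n X (k + m)))"

definition orlicz_term :: "(real \<Rightarrow> real) \<Rightarrow> real \<Rightarrow> (nat \<Rightarrow> fuzzy) \<Rightarrow> nat \<Rightarrow> real" where
  "orlicz_term M \<rho> Y k = M (fuzzy_dist (Y k) (crisp 0) / \<rho>)"

text \<open>The series run over indices from 1, hence the shift by \<open>Suc\<close>; all their terms are
  nonnegative, so \<open>summable\<close> says that the sum is finite.\<close>

definition ces_F_Delta :: "real \<Rightarrow> (real \<Rightarrow> real) \<Rightarrow> nat \<Rightarrow> nat \<Rightarrow> (nat \<Rightarrow> fuzzy) set" where
  "ces_F_Delta p M m n =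
     {X. (\<forall>k\<ge>1. X k \<in> RI) \<and>
         (\<exists>\<rho>>0. summable (\<lambda>i.
            (1 / real (Suc i) * (\<Sum>k=1..Suc i. orlicz_term M \<rho> (fuzzy_Delta m n X) k)) powr p))}"

definition ell_F_Delta :: "real \<Rightarrow> (real \<Rightarrow> real) \<Rightarrow> nat \<Rightarrow> nat \<Rightarrow> (nat \<Rightarrow> fuzzy) set" where
  "ell_F_Delta p M m n =
     {X. (\<forall>k\<ge>1. X k \<in> RI) \<and>
         (\<exists>\<rho>>0. summable (\<lambda>k. orlicz_term M \<rho> (fuzzy_Delta m n X) (Suc k) powr p))}"

definition ces_F :: "real \<Rightarrow> (real \<Rightarrow> real) \<Rightarrow> (nat \<Rightarrow> fuzzy) set" where
  "ces_F p M =
     {X. (\<forall>k\<ge>1. X k \<in> RI) \<and>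
         (\<exists>\<rho>>0. summable (\<lambda>i. (1 / real (Suc i) * (\<Sum>k=1..Suc i. orlicz_term M \<rho> X k)) powr p))}"

end

theory Submission
  imports Defs
begin

text \<open>Part (a): the terms of a convergent series \<open>\<Sum> a\<^sub>k\<^sup>p\<close> are eventually at most 1, and then
  \<open>a\<^sub>k\<^sup>q \<le> a\<^sub>k\<^sup>p\<close>.

  Part (b): it is enough to treat one difference step \<open>X\<^sub>k - X\<^bsub>k+m\<^esub>\<close> and to iterate. The distance
  to \<open>0\<close> is subadditive under subtraction, so by convexity of \<open>M\<close> the term of the difference at
  scale \<open>2 \<rho>\<close> is at most the mean of the terms of \<open>X\<close> at \<open>k\<close> and \<open>k + m\<close> at scale \<open>\<rho>\<close>. Hence the
  \<open>i\<close>-th partial sum is at most the \<open>(i + m)\<close>-th one of \<open>X\<close>, and the \<open>i\<close>-th average is at most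
  \<open>(i + m) / i \<le> m + 1\<close> times the \<open>(i + m)\<close>-th average of \<open>X\<close>.\<close>

lemma summable_powr_mono:
  fixes a :: "nat \<Rightarrow> real"
  assumes "summable (\<lambda>k. a k powr p)" and "0 < p" "p \<le> q"
  shows "summable (\<lambda>k. a k powr q)"
proof (rule summable_comparison_test_ev[OF _ assms(1)])
  have "(\<lambda>k. a k powr p) \<longlonglongrightarrow> 0"
    using assms(1) by (rule summable_LIMSEQ_zero)
  then have "\<forall>\<^sub>F k in sequentially. a k powr p < 1"
    by (rule order_tendstoD) simp
  then show "\<forall>\<^sub>F k in sequentially. norm (a k powr q) \<le> a k powr p"
  proof eventually_elim
    case (elim k)
    \<comment> \<open>The base \<open>a k powr p\<close> lies in [0, 1) and \<open>q / p\<close> is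
      at least 1, so this power cannot exceed its base.\<close>
    have "a k powr q = (a k powr p) powr (q / p)"
      using assms by (simp add: powr_powr)
    also have "\<dots> \<le> (a k powr p) powr 1"
      using elim assms by (intro powr_mono') auto
    finally show ?case by simp
  qed
qed

lemma fuzzy_dist_nonneg:
  assumes "X \<in> RI" "Y \<in> RI"
  shows "0 \<le> fuzzy_dist X Y"
proof -
  have "0 \<le> interval_dist (level X 1) (level Y 1)"
    by (auto simp: interval_dist_def)
  also have "\<dots> \<le> fuzzy_dist X Y"
    unfolding fuzzy_dist_def by (rule cSUP_upper[OF _ bdd_above_interval_dist[OF assms]]) simp
  finally show ?thesis .
qed

lemma interval_dist_le_fuzzy_dist:
  assumes "X \<in> RI" "Y \<in> RI" "\<alpha> \<in> {0<..1}"
  shows "interval_dist (level X \<alpha>) (level Y \<alpha>) \<le> fuzzy_dist X Y"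
  unfolding fuzzy_dist_def
  by (rule cSUP_upper[OF assms(3) bdd_above_interval_dist[OF assms(1,2)]])

text \<open>Each endpoint of a difference pairs opposite ends of the two intervals, and the distance
  of an interval to 0 is its largest endpoint modulus, so the triangle inequality works level by
  level.\<close>

lemma fuzzy_dist_minus_crisp_zero_le:
  assumes X: "X \<in> RI" and Y: "Y \<in> RI"
  shows "fuzzy_dist (fuzzy_minus X Y) (crisp 0) \<le> fuzzy_dist X (crisp 0) + fuzzy_dist Y (crisp 0)"
  unfolding fuzzy_dist_def[of "fuzzy_minus X Y"]
proof (rule cSUP_least)
  fix \<alpha> :: real assume a: "\<alpha> \<in> {0<..1}"
  note le = interval_dist_le_fuzzy_dist[OF _ crisp_in_RI a, of _ 0]
  have "interval_dist (level (fuzzy_minus X Y) \<alpha>) (level (crisp 0) \<alpha>)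
      = max \<bar>Inf (level X \<alpha>) - Sup (level Y \<alpha>)\<bar> \<bar>Sup (level X \<alpha>) - Inf (level Y \<alpha>)\<bar>"
    using a RI_level(2)[OF X, of \<alpha>] RI_level(2)[OF Y, of \<alpha>]
    by (simp add: level_fuzzy_minus[OF X Y] level_crisp interval_minus_def interval_dist_def)
  also have "\<dots> \<le> max (\<bar>Inf (level X \<alpha>)\<bar>) (\<bar>Sup (level X \<alpha>)\<bar>)
      + max (\<bar>Inf (level Y \<alpha>)\<bar>) (\<bar>Sup (level Y \<alpha>)\<bar>)"
    by (intro max.boundedI order.trans[OF abs_triangle_ineq4] add_mono max.cobounded1 max.cobounded2)
  also have "\<dots> = interval_dist (level X \<alpha>) (level (crisp 0) \<alpha>)
      + interval_dist (level Y \<alpha>) (level (crisp 0) \<alpha>)"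
    using a by (simp add: level_crisp interval_dist_def)
  also have "\<dots> \<le> fuzzy_dist X (crisp 0) + fuzzy_dist Y (crisp 0)"
    by (intro add_mono le X Y)
  finally show "interval_dist (level (fuzzy_minus X Y) \<alpha>) (level (crisp 0) \<alpha>)
      \<le> fuzzy_dist X (crisp 0) + fuzzy_dist Y (crisp 0)" .
qed simp

lemma orlicz_nonneg: "orlicz M \<Longrightarrow> 0 \<le> x \<Longrightarrow> 0 \<le> M x"
  by (auto simp: orlicz_def)

lemma orlicz_mono: "orlicz M \<Longrightarrow> 0 \<le> x \<Longrightarrow> x \<le> y \<Longrightarrow> M x \<le> M y"
  by (auto simp: orlicz_def mono_on_def)

lemma orlicz_midpoint_le:
  assumes "orlicz M" "0 \<le> x" "0 \<le> y"
  shows "M ((x + y) / 2) \<le> (M x + M y) / 2"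
proof -
  have "convex_on {0..} M" using assms(1) by (simp add: orlicz_def)
  from convex_onD[OF this, of "1/2" x y] assms show ?thesis
    by (simp add: field_simps)
qed

lemma orlicz_term_nonneg:
  assumes "orlicz M" "0 < \<rho>" "Y k \<in> RI"
  shows "0 \<le> orlicz_term M \<rho> Y k"
  unfolding orlicz_term_def
  using assms(2,3) by (intro orlicz_nonneg[OF assms(1)] divide_nonneg_pos fuzzy_dist_nonneg crisp_in_RI)

lemma orlicz_term_minus_le:
  assumes M: "orlicz M" and \<rho>: "0 < \<rho>" and Y: "Y k \<in> RI" "Y (k + m) \<in> RI"
  shows "orlicz_term M (2 * \<rho>) (\<lambda>k. fuzzy_minus (Y k) (Y (k + m))) k
    \<le> (orlicz_term M \<rho> Y k + orlicz_term M \<rho> Y (k + m)) / 2"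
proof -
  let ?x = "fuzzy_dist (Y k) (crisp 0)" and ?y = "fuzzy_dist (Y (k + m)) (crisp 0)"
  let ?z = "fuzzy_dist (fuzzy_minus (Y k) (Y (k + m))) (crisp 0)"
  have nn: "0 \<le> ?x" "0 \<le> ?y" "0 \<le> ?z"
    using Y by (auto intro: fuzzy_dist_nonneg crisp_in_RI fuzzy_minus_in_RI)
  \<comment> \<open>Doubling the scale turns the subadditivity bound into a midpoint, to which
    convexity of \<open>M\<close> applies.\<close>
  have "?z / (2 * \<rho>) \<le> (?x / \<rho> + ?y / \<rho>) / 2"
    using fuzzy_dist_minus_crisp_zero_le[OF Y] \<rho> by (simp add: field_simps)
  then have "M (?z / (2 * \<rho>)) \<le> M ((?x / \<rho> + ?y / \<rho>) / 2)"
    using nn \<rho> by (intro orlicz_mono[OF M]) auto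
  also have "\<dots> \<le> (M (?x / \<rho>) + M (?y / \<rho>)) / 2"
    using nn \<rho> by (intro orlicz_midpoint_le[OF M]) auto
  finally show ?thesis by (simp add: orlicz_term_def)
qed

text \<open>Closure of the whole space allows iteration: the scale doubles at each step, but
  membership only asks for some scale.\<close>

lemma ces_F_minus_shift:
  assumes M: "orlicz M" and p: "0 \<le> p" and Y: "Y \<in> ces_F p M"
  shows "(\<lambda>k. fuzzy_minus (Y k) (Y (k + m))) \<in> ces_F p M"
proof -
  let ?Z = "\<lambda>k. fuzzy_minus (Y k) (Y (k + m))"
  have RI: "Y k \<in> RI" if "k \<ge> 1" for k using Y that by (auto simp: ces_F_def)
  then have RIZ: "?Z k \<in> RI" if "k \<ge> 1" for k using that by (simp add: fuzzy_minus_in_RI)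
  obtain \<rho> where \<rho>: "0 < \<rho>" and sm: "summable (\<lambda>i.
      (1 / real (Suc i) * (\<Sum>k=1..Suc i. orlicz_term M \<rho> Y k)) powr p)"
    using Y by (auto simp: ces_F_def)
  let ?t = "orlicz_term M \<rho> Y" and ?u = "orlicz_term M (2 * \<rho>) ?Z"
  \<comment> \<open>Indices start at 1 because \<open>Y 0\<close> need not lie in
    \<open>RI\<close>.\<close>
  have t: "0 \<le> ?t k" if "k \<ge> 1" for k using orlicz_term_nonneg[OF M \<rho>] RI that by blast
  have u: "0 \<le> ?u k" if "k \<ge> 1" for k
    using orlicz_term_nonneg[OF M, of "2 * \<rho>" ?Z] \<rho> RIZ that by simp
  have sums: "(\<Sum>k=1..j. ?u k) \<le> (\<Sum>k=1..j+m. ?t k)" for j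
  proof -
    have "(\<Sum>k=1..j. ?u k) \<le> (\<Sum>k=1..j. (?t k + ?t (k + m)) / 2)"
      using RI by (intro sum_mono orlicz_term_minus_le[OF M \<rho>]) auto
    also have "\<dots> = ((\<Sum>k=1..j. ?t k) + (\<Sum>k=1+m..j+m. ?t k)) / 2"
      by (simp only: sum.shift_bounds_cl_nat_ivl sum.distrib sum_divide_distrib[symmetric])
    also have "\<dots> \<le> (\<Sum>k=1..j+m. ?t k)"
    proof -
      \<comment> \<open>Both index ranges lie inside \<open>{1..j+m}\<close>, where the terms are
        nonnegative; the factor 1/2 offsets having two sums.\<close>
      have "(\<Sum>k=1..j. ?t k) \<le> (\<Sum>k=1..j+m. ?t k)" "(\<Sum>k=1+m..j+m. ?t k) \<le> (\<Sum>k=1..j+m. ?t k)"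
        using t by (auto intro!: sum_mono2)
      then show ?thesis by simp
    qed
    finally show ?thesis .
  qed
  have avg: "1 / real (Suc i) * (\<Sum>k=1..Suc i. ?u k)
      \<le> (real m + 1) * (1 / real (Suc (i + m)) * (\<Sum>k=1..Suc (i + m). ?t k))" for i
  proof -
    have S: "0 \<le> (\<Sum>k=1..Suc (i + m). ?t k)" using t by (intro sum_nonneg) auto
    have "1 / real (Suc i) * (\<Sum>k=1..Suc i. ?u k) \<le> 1 / real (Suc i) * (\<Sum>k=1..Suc (i + m). ?t k)"
      using sums[of "Suc i"] by (intro mult_left_mono) auto
    \<comment> \<open>This amounts to i + 1 + m \<le> (m + 1) (i + 1).\<close>
    also have "\<dots> \<le> ((real m + 1) / real (Suc (i + m))) * (\<Sum>k=1..Suc (i + m). ?t k)"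
      using S by (intro mult_right_mono) (auto simp: field_simps)
    finally show ?thesis by simp
  qed
  have "summable (\<lambda>i. (1 / real (Suc i) * (\<Sum>k=1..Suc i. ?u k)) powr p)"
  proof (rule summable_comparison_test')
    \<comment> \<open>The majorant is a tail of the convergent series for \<open>Y\<close>, scaled
      by a constant.\<close>
    show "summable (\<lambda>i. (real m + 1) powr p *
        (1 / real (Suc (i + m)) * (\<Sum>k=1..Suc (i + m). ?t k)) powr p)"
      using summable_ignore_initial_segment[OF sm, of m] by (rule summable_mult)
    fix i :: nat
    have "(1 / real (Suc i) * (\<Sum>k=1..Suc i. ?u k)) powr p
        \<le> ((real m + 1) * (1 / real (Suc (i + m)) * (\<Sum>k=1..Suc (i + m). ?t k))) powr p"
      using avg[of i] p u by (intro powr_mono2 mult_nonneg_nonneg sum_nonneg) auto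
    also have "\<dots> = (real m + 1) powr p *
        (1 / real (Suc (i + m)) * (\<Sum>k=1..Suc (i + m). ?t k)) powr p"
      by (rule powr_mult)
    finally show "norm ((1 / real (Suc i) * (\<Sum>k=1..Suc i. ?u k)) powr p)
        \<le> (real m + 1) powr p * (1 / real (Suc (i + m)) * (\<Sum>k=1..Suc (i + m). ?t k)) powr p"
      by simp
  qed
  then show ?thesis
    unfolding ces_F_def using RIZ \<rho> by (intro CollectI conjI exI[of _ "2 * \<rho>"]) simp_all
qed

lemma fuzzy_Delta_in_ces_F:
  assumes "orlicz M" "0 \<le> p" "X \<in> ces_F p M"
  shows "fuzzy_Delta m n X \<in> ces_F p M"
proof (induction n)
  case (Suc n)
  \<comment> \<open>For \<open>m = 0\<close> the difference is \<open>X\<close> itself by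
    convention; otherwise the closure lemma supplies one more step.\<close>
  then show ?case
    using assms ces_F_minus_shift[OF assms(1,2) Suc, of m] by (cases "m = 0") simp_all
qed (use assms in simp)

theorem theorem3p6:
  fixes M :: "real \<Rightarrow> real"
  assumes "orlicz M"
  shows "(\<forall>(m::nat) (n::nat) (p::real) (q::real). 1 \<le> p \<and> p < q \<longrightarrow>
            ces_F_Delta p M m n \<subseteq> ces_F_Delta q M m n \<and>
            ell_F_Delta p M m n \<subseteq> ell_F_Delta q M m n) \<and>
         (\<forall>p::real. 1 \<le> p \<longrightarrow>
            (\<forall>(m::nat) (n::nat). 1 \<le> m \<and> 1 \<le> n \<longrightarrow> ces_F p M \<subseteq> ces_F_Delta p M m n))"
proof (intro conjI allI impI)
  fix m n :: nat and p q :: real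
  assume pq: "1 \<le> p \<and> p < q"
  have sm: "summable (\<lambda>k. a k powr q)" if "summable (\<lambda>k. a k powr p)" for a :: "nat \<Rightarrow> real"
    using pq by (intro summable_powr_mono[OF that]) auto
  \<comment> \<open>The same \<rho> witnesses both memberships, since only the exponent
    changes.\<close>
  show "ces_F_Delta p M m n \<subseteq> ces_F_Delta q M m n"
    unfolding ces_F_Delta_def by (intro Collect_mono impI conj_mono ex_mono sm)
  show "ell_F_Delta p M m n \<subseteq> ell_F_Delta q M m n"
    unfolding ell_F_Delta_def by (intro Collect_mono impI conj_mono ex_mono sm)
next
  fix p :: real and m n :: nat
  assume "1 \<le> p"
  show "ces_F p M \<subseteq> ces_F_Delta p M m n"
  proof
    fix X assume X: "X \<in> ces_F p M"
    then have "fuzzy_Delta m n X \<in> ces_F p M"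
      using assms \<open>1 \<le> p\<close> by (intro fuzzy_Delta_in_ces_F) auto
    \<comment> \<open>Summability comes from the difference sequence in \<open>ces_F\<close>, and
      the condition on \<open>RI\<close> from \<open>X\<close> itself.\<close>
    then show "X \<in> ces_F_Delta p M m n"
      using X by (simp add: ces_F_def ces_F_Delta_def)
  qed
qed

end
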